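(* Let $R=\mathbb{C}[x_1,\ldots,x_d]$. For each set $S\subseteq R$ the set $S^{( * )}$ is a power-closed ideal, and the operation $S\mapsto S^{( * )}$ is a closure operator: (i) $S\subseteq S^{( * )}$ for each subset $S\subseteq R$; (ii) $S\subseteq T\subseteq R$ implies $S^{( * )}\subseteq T^{( * )}$; and (iii) $(S^{( * )})^{( * )}=S^{( * )}$ for each $S\subseteq R$. Moreover, the set of power-closed ideals is a complete sublattice of the complete lattice of ideals of $R$ (ordered by inclusion, with meet given by intersection and join given by sum): if $\mathcal{S}$ is a family of power-closed ideals of $R$, then both $\bigcap_{S\in\mathcal{S}}S$ and $\sum_{S\in\mathcal{S}}S$ are power-closed ideals.
   Context: For $f=f(x_1,\ldots,x_d)\in R$ and $i\in\mathbb{N}=\{1,2,\ldots\}$, put $f^{(i)}=f(x_1^i,\ldots,x_d^i)$. An ideal $I$ of $R$ is power-closed if $f\in I$ implies $f^{(i)}\in I$ for every $i\in\mathbb{N}$. For a subset $S\subseteq R$, $S^{( * )}$ denotes the intersection of all power-closed ideals of $R$ containing $S$. (Equivalently, it is the ideal generated by all $f^{(\ell)}$ with $f\in S$, $\ell\in\mathbb{N}$.) *)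

theory Defs
  imports Complex_Main "HOL-Library.Poly_Mapping" "HOL-Algebra.Complete_Lattice" "HOL-Algebra.Ideal"
begin

section \<open>The polynomial ring in the variables $x_1, \ldots, x_d$ over the complex numbers\<close>

text \<open>
  A monomial is a finitely supported exponent vector; a polynomial is a finitely supported map from
  monomials to coefficients, with the convolution product of \<^theory>\<open>HOL-Library.Poly_Mapping\<close>.
  The type provides the variables $x_0, x_1, x_2, \ldots$; the ring for a given $d$ is cut
  out by its carrier.
\<close>

type_synonym cpoly = "(nat \<Rightarrow>\<^sub>0 nat) \<Rightarrow>\<^sub>0 complex"

definition cpoly_ring :: "nat \<Rightarrow> cpoly ring" where
  "cpoly_ring d =
    \<lparr>carrier = {f. \<forall>m \<in> Poly_Mapping.keys f. Poly_Mapping.keys m \<subseteq> {1..d}},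
     monoid.mult = (*), one = 1, ring.zero = 0, add = (+)\<rparr>"

definition cpoly_var :: "nat \<Rightarrow> cpoly" where
  "cpoly_var j = Poly_Mapping.single (Poly_Mapping.single j 1) 1"

definition cpoly_const :: "complex \<Rightarrow> cpoly" where
  "cpoly_const c = Poly_Mapping.single 0 c"

definition cpoly_subst :: "(nat \<Rightarrow> cpoly) \<Rightarrow> cpoly \<Rightarrow> cpoly" where
  "cpoly_subst y f = (\<Sum>m \<in> Poly_Mapping.keys f. cpoly_const (Poly_Mapping.lookup f m) * (\<Prod>j \<in> Poly_Mapping.keys m. y j ^ Poly_Mapping.lookup m j))"

lemma cpoly_ring_cring: "cring (cpoly_ring d)"
proof -
  let ?C = "{f :: cpoly. \<forall>m \<in> Poly_Mapping.keys f. Poly_Mapping.keys m \<subseteq> {1..d}}"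
  have mult: "f * g \<in> ?C" if fg: "f \<in> ?C" "g \<in> ?C" for f g
  proof (rule CollectI, rule ballI)
    fix m assume "m \<in> Poly_Mapping.keys (f * g)"
    then obtain a b where ab: "m = a + b" "a \<in> Poly_Mapping.keys f" "b \<in> Poly_Mapping.keys g"
      using keys_mult[of f g] by blast
    have "Poly_Mapping.keys a \<subseteq> {1..d}" "Poly_Mapping.keys b \<subseteq> {1..d}"
      using ab fg by (blast, blast)
    then show "Poly_Mapping.keys m \<subseteq> {1..d}"
      unfolding ab(1) using keys_add[of a b] by (meson Un_least subset_trans)
  qed
  have add: "f + g \<in> ?C" if "f \<in> ?C" "g \<in> ?C" for f g
    using that keys_add[of f g] by blast
  have zero: "0 \<in> ?C" and one: "1 \<in> ?C"
    by simp_all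
  have uminus: "- f \<in> ?C" if "f \<in> ?C" for f
    using that by simp
  show ?thesis
  proof (rule cringI)
    show "abelian_group (cpoly_ring d)"
    proof (rule abelian_groupI, unfold cpoly_ring_def ring_record_simps partial_object.simps)
      fix f assume "f \<in> ?C"
      then show "\<exists>g \<in> ?C. g + f = 0"
        using uminus by (intro bexI[of _ "- f"]) simp_all
    qed (fact add zero | simp only: add.assoc add.commute add_0_left | simp add: ac_simps)+
    show "Group.comm_monoid (cpoly_ring d)"
      by (rule comm_monoidI, unfold cpoly_ring_def monoid.simps partial_object.simps)
         (fact mult one | simp only: mult.assoc mult.commute mult_1_left | simp add: ac_simps)+
  qed (simp add: cpoly_ring_def distrib_right)
qed


section \<open>Power-closed ideals\<close>

text \<open>$f^{(i)} = f(x_1^i, \ldots, x_d^i)$\<close>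

definition power_subst :: "nat \<Rightarrow> cpoly \<Rightarrow> cpoly" where
  "power_subst i f = cpoly_subst (\<lambda>j. cpoly_var j ^ i) f"

definition power_closed_ideal :: "nat \<Rightarrow> cpoly set \<Rightarrow> bool" where
  "power_closed_ideal d I \<longleftrightarrow>
    ideal I (cpoly_ring d) \<and> (\<forall>f \<in> I. \<forall>i \<ge> 1. power_subst i f \<in> I)"

text \<open>$S^{(*)}$, for a subset \<open>S\<close> of the carrier\<close>

definition power_closure :: "nat \<Rightarrow> cpoly set \<Rightarrow> cpoly set" where
  "power_closure d S = \<Inter> {I. power_closed_ideal d I \<and> S \<subseteq> I}"


section \<open>The lattice of ideals\<close>

definition ideal_lattice :: "('a, 'b) ring_scheme \<Rightarrow> 'a set gorder" where
  "ideal_lattice R = \<lparr>carrier = {I. ideal I R}, eq = (=), le = (\<subseteq>)\<rparr>"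

text \<open>
  The intersection is taken inside \<open>carrier R\<close>, so that the empty family gives the whole ring.
\<close>

definition ideals_Inter :: "('a, 'b) ring_scheme \<Rightarrow> 'a set set \<Rightarrow> 'a set" where
  "ideals_Inter R \<S> = carrier R \<inter> \<Inter> \<S>"

text \<open>
  The sum of a possibly infinite family of ideals consists of the finite sums of elements taken
  from members of the family; the empty family gives the zero ideal.
\<close>

definition ideals_sum :: "('a, 'b) ring_scheme \<Rightarrow> 'a set set \<Rightarrow> 'a set" where
  "ideals_sum R \<S> =
    {finsum R g F | F g. finite F \<and> F \<subseteq> \<S> \<and> (\<forall>I \<in> F. g I \<in> I)}"

definition complete_sublattice :: "'a set \<Rightarrow> 'a gorder \<Rightarrow> bool" where
  "complete_sublattice A L \<longleftrightarrow>
    complete_lattice L \<and> A \<subseteq> carrier L \<and>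
    (\<forall>X \<subseteq> A. \<Sqinter>\<^bsub>L\<^esub>X \<in> A \<and> \<Squnion>\<^bsub>L\<^esub>X \<in> A)"

end

theory Submission
  imports Defs
begin

text \<open>
  Everything rests on one observation: for fixed \<open>i\<close> the map \<open>f \<mapsto> f\<^sup>(\<^sup>i\<^sup>)\<close> is an additive map of the
  polynomial ring into itself. An element of the sum of a family of ideals is a finite sum of
  elements of its members. An additive map that sends each member into itself acts on the summands
  separately, hence sends the sum of the family into itself. Applied to left and right
  multiplication by a ring element, this shows that the sum is an ideal; applied to \<open>f \<mapsto> f\<^sup>(\<^sup>i\<^sup>)\<close>, it shows that the sum of power-closed
  ideals is power-closed. The lemma \<open>ideals_sum_additive_invariant\<close> is this argument.

  If \<open>f\<close> lies in every member of a family of power-closed ideals, then so does \<open>f\<^sup>(\<^sup>i\<^sup>)\<close>; and the whole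
  ring, which is the intersection of the empty family, is power-closed because substituting powers
  introduces no new variables. Hence the power-closed ideals form a closure system, and
  \<open>S \<mapsto> S\<^sup>(\<^sup>*\<^sup>)\<close> is the associated closure operator. In the lattice of all ideals,
  intersections and sums are the infima and suprema, so the two closure properties say that the
  power-closed ideals are a complete sublattice.
\<close>

section \<open>Intersections and sums of families of ideals\<close>

context ring
begin

lemma additive_map_finsum:
  assumes "\<phi> \<in> hom (add_monoid R) (add_monoid R)" "finite A" "g \<in> A \<rightarrow> carrier R"
  shows "\<phi> (finsum R g A) = finsum R (\<lambda>a. \<phi> (g a)) A"
proof -
  interpret \<phi>: abelian_group_hom R R \<phi>
    using assms(1) by (intro abelian_group_homI group_hom.intro group_hom_axioms.intro)
      (auto intro: abelian_group_axioms add.is_group)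
  show ?thesis
    using assms(2,3) by (induction A) (simp_all add: Pi_iff)
qed

lemma left_mult_additive: "x \<in> carrier R \<Longrightarrow> (\<lambda>a. x \<otimes> a) \<in> hom (add_monoid R) (add_monoid R)"
  by (simp add: hom_def r_distr)

lemma right_mult_additive: "x \<in> carrier R \<Longrightarrow> (\<lambda>a. a \<otimes> x) \<in> hom (add_monoid R) (add_monoid R)"
  by (simp add: hom_def l_distr)

lemma ideals_Inter_ideal:
  assumes "\<And>I. I \<in> \<S> \<Longrightarrow> ideal I R"
  shows "ideal (ideals_Inter R \<S>) R"
proof -
  have "ideals_Inter R \<S> = \<Inter> (insert (carrier R) \<S>)"
    by (simp add: ideals_Inter_def)
  then show ?thesis
    using i_Intersect[of "insert (carrier R) \<S>"] assms oneideal by auto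
qed

text \<open>
  The image of a finite sum is the sum of the images, and each image stays in the ideal from which
  its summand was taken. With \<open>\<phi>\<close> a multiplication this gives closure of the sum under
  multiplication by ring elements, with \<open>\<phi>\<close> a power substitution it gives power-closedness.
\<close>

lemma ideals_sum_additive_invariant:
  assumes "\<And>I. I \<in> \<S> \<Longrightarrow> I \<subseteq> carrier R"
    and "\<phi> \<in> hom (add_monoid R) (add_monoid R)"
    and "\<And>I a. \<lbrakk>I \<in> \<S>; a \<in> I\<rbrakk> \<Longrightarrow> \<phi> a \<in> I"
    and "a \<in> ideals_sum R \<S>"
  shows "\<phi> a \<in> ideals_sum R \<S>"
proof -
  obtain F g where F: "a = finsum R g F" "finite F" "F \<subseteq> \<S>" "\<forall>I \<in> F. g I \<in> I"
    using assms(4) unfolding ideals_sum_def by blast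
  have "\<phi> a = finsum R (\<lambda>I. \<phi> (g I)) F"
    unfolding F(1) using assms(1,2) F by (intro additive_map_finsum) auto
  moreover have "\<forall>I \<in> F. \<phi> (g I) \<in> I"
    using assms(3) F by blast
  ultimately show ?thesis
    unfolding ideals_sum_def using F by blast
qed

lemma ideals_sum_add:
  assumes id: "\<And>I. I \<in> \<S> \<Longrightarrow> ideal I R"
    and "a \<in> ideals_sum R \<S>" "b \<in> ideals_sum R \<S>"
  shows "a \<oplus> b \<in> ideals_sum R \<S>"
proof -
  obtain F g where F: "a = finsum R g F" "finite F" "F \<subseteq> \<S>" "\<forall>I \<in> F. g I \<in> I"
    using assms(2) unfolding ideals_sum_def by blast
  obtain G h where G: "b = finsum R h G" "finite G" "G \<subseteq> \<S>" "\<forall>I \<in> G. h I \<in> I"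
    using assms(3) unfolding ideals_sum_def by blast
  \<comment> \<open>An ideal may contribute to both sums, but only one summand per ideal is allowed. Extending\<close>
  \<comment> \<open>both sums by zero to \<open>F \<union> G\<close> lets the two contributions be added inside that ideal.\<close>
  define g' where "g' I = (if I \<in> F then g I else \<zero>)" for I
  define h' where "h' I = (if I \<in> G then h I else \<zero>)" for I
  have g': "g' I \<in> I" and h': "h' I \<in> I" and sub: "I \<subseteq> carrier R"
    and gh: "g' I \<oplus> h' I \<in> I" if "I \<in> F \<union> G" for I
  proof -
    interpret I: ideal I R
      using id that F(3) G(3) by blast
    show "g' I \<in> I" "h' I \<in> I" "I \<subseteq> carrier R"
      using F(4) G(4) I.zero_closed I.a_subset by (auto simp: g'_def h'_def)
    then show "g' I \<oplus> h' I \<in> I"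
      by (simp add: I.a_closed)
  qed
  have car: "g' \<in> F \<union> G \<rightarrow> carrier R" "h' \<in> F \<union> G \<rightarrow> carrier R"
    using g' h' sub by blast+
  have "a = finsum R g' (F \<union> G)"
    unfolding F(1) using car F(2) G(2)
    by (intro add.finprod_mono_neutral_cong_left) (auto simp: g'_def)
  moreover have "b = finsum R h' (F \<union> G)"
    unfolding G(1) using car F(2) G(2)
    by (intro add.finprod_mono_neutral_cong_left) (auto simp: h'_def)
  ultimately have "a \<oplus> b = finsum R (\<lambda>I. g' I \<oplus> h' I) (F \<union> G)"
    using car by (simp add: finsum_addf)
  then show ?thesis
    unfolding ideals_sum_def using F(2,3) G(2,3) gh by blast
qed

lemma finsum_mem_ideal:
  assumes "ideal J R" "finite F" "\<And>i. i \<in> F \<Longrightarrow> g i \<in> J"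
  shows "finsum R g F \<in> J"
proof -
  interpret J: ideal J R by fact
  show ?thesis
    using assms(2,3) by (induction F) (auto simp: Pi_iff J.a_closed)
qed

lemma ideals_sum_least:
  assumes "ideal J R" "\<And>I. I \<in> \<S> \<Longrightarrow> I \<subseteq> J"
  shows "ideals_sum R \<S> \<subseteq> J"
  unfolding ideals_sum_def using assms by (auto intro!: finsum_mem_ideal)

lemma ideals_sum_upper:
  assumes "I \<in> \<S>" "I \<subseteq> carrier R"
  shows "I \<subseteq> ideals_sum R \<S>"
proof
  fix a assume "a \<in> I"
  then have "a = finsum R (\<lambda>_. a) {I}" "\<forall>K \<in> {I}. a \<in> K"
    using assms(2) by auto
  then show "a \<in> ideals_sum R \<S>"
    unfolding ideals_sum_def using assms(1) by (intro CollectI exI[of _ "{I}"] exI) auto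
qed

lemma ideals_sum_ideal:
  assumes id: "\<And>I. I \<in> \<S> \<Longrightarrow> ideal I R"
  shows "ideal (ideals_sum R \<S>) R"
proof -
  have sub: "I \<subseteq> carrier R" if "I \<in> \<S>" for I
    using id[OF that] by (rule ideal.Icarr[THEN subsetI])
  have l: "x \<otimes> a \<in> ideals_sum R \<S>" if "a \<in> ideals_sum R \<S>" "x \<in> carrier R" for a x
    by (rule ideals_sum_additive_invariant[OF sub left_mult_additive[OF that(2)] _ that(1)])
      (auto intro: ideal.I_l_closed id that(2))
  have r: "a \<otimes> x \<in> ideals_sum R \<S>" if "a \<in> ideals_sum R \<S>" "x \<in> carrier R" for a x
    by (rule ideals_sum_additive_invariant[OF sub right_mult_additive[OF that(2)] _ that(1)])
      (auto intro: ideal.I_r_closed id that(2))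
  have carr: "ideals_sum R \<S> \<subseteq> carrier R"
    by (rule ideals_sum_least[OF oneideal sub])
  have zero: "\<zero> \<in> ideals_sum R \<S>"
    unfolding ideals_sum_def by (intro CollectI exI[of _ "{}"]) simp
  show ?thesis
  proof (rule idealI[OF ring_axioms add.subgroupI l r])
    fix a assume a: "a \<in> ideals_sum R \<S>"
    have "\<ominus> a = (\<ominus> \<one>) \<otimes> a"
      using a carr by (auto simp: l_minus)
    then show "\<ominus> a \<in> ideals_sum R \<S>"
      using l[OF a, of "\<ominus> \<one>"] by simp
  qed (use carr zero ideals_sum_add[OF id] in auto)
qed

lemma ideal_lattice_partial_order: "partial_order (ideal_lattice R)"
  by unfold_locales (auto simp: ideal_lattice_def)

lemma ideals_sum_is_lub:
  assumes id: "\<And>I. I \<in> \<S> \<Longrightarrow> ideal I R"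
  shows "least (ideal_lattice R) (ideals_sum R \<S>) (Upper (ideal_lattice R) \<S>)"
proof -
  have "I \<subseteq> ideals_sum R \<S>" if "I \<in> \<S>" for I
    using ideals_sum_upper[OF that] ideal.Icarr[OF id[OF that]] by blast
  moreover have "ideals_sum R \<S> \<subseteq> J" if "J \<in> Upper (ideal_lattice R) \<S>" for J
    using that id by (intro ideals_sum_least) (auto simp: Upper_def ideal_lattice_def)
  ultimately show ?thesis
    using ideals_sum_ideal[OF id]
    by (auto simp: least_def Upper_def ideal_lattice_def)
qed

lemma ideals_Inter_is_glb:
  assumes id: "\<And>I. I \<in> \<S> \<Longrightarrow> ideal I R"
  shows "greatest (ideal_lattice R) (ideals_Inter R \<S>) (Lower (ideal_lattice R) \<S>)"
proof -
  have "J \<subseteq> ideals_Inter R \<S>" if "J \<in> Lower (ideal_lattice R) \<S>" for J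
    using that id ideal.Icarr[of J R]
    by (fastforce simp: Lower_def ideal_lattice_def ideals_Inter_def)
  then show ?thesis
    using ideals_Inter_ideal[OF id]
    by (auto simp: greatest_def Lower_def ideal_lattice_def ideals_Inter_def)
qed

lemma ideal_lattice_complete: "complete_lattice (ideal_lattice R)"
proof -
  interpret partial_order "ideal_lattice R"
    by (rule ideal_lattice_partial_order)
  show ?thesis
  proof
    fix \<S> assume "\<S> \<subseteq> carrier (ideal_lattice R)"
    then have "ideal I R" if "I \<in> \<S>" for I
      using that by (auto simp: ideal_lattice_def)
    then show "\<exists>s. least (ideal_lattice R) s (Upper (ideal_lattice R) \<S>)"
      and "\<exists>i. greatest (ideal_lattice R) i (Lower (ideal_lattice R) \<S>)"
      using ideals_sum_is_lub ideals_Inter_is_glb by blast+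
  qed
qed

lemma ideal_lattice_sup_inf:
  assumes id: "\<And>I. I \<in> \<S> \<Longrightarrow> ideal I R"
  shows "\<Squnion>\<^bsub>ideal_lattice R\<^esub>\<S> = ideals_sum R \<S>"
    and "\<Sqinter>\<^bsub>ideal_lattice R\<^esub>\<S> = ideals_Inter R \<S>"
proof -
  interpret L: partial_order "ideal_lattice R"
    by (rule ideal_lattice_partial_order)
  show "\<Squnion>\<^bsub>ideal_lattice R\<^esub>\<S> = ideals_sum R \<S>"
    unfolding sup_def using ideals_sum_is_lub[OF id]
    by (intro some_equality L.least_unique)
  show "\<Sqinter>\<^bsub>ideal_lattice R\<^esub>\<S> = ideals_Inter R \<S>"
    unfolding inf_def using ideals_Inter_is_glb[OF id]
    by (intro some_equality L.greatest_unique)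
qed

end


section \<open>The power substitution as an additive map\<close>

text \<open>
  Substitution acts on each monomial separately and is linear in its coefficient, so sums can be
  compared monomial by monomial, even where terms of \<open>f\<close> and \<open>g\<close> cancel.
\<close>

lemma cpoly_subst_add: "cpoly_subst y (f + g) = cpoly_subst y f + cpoly_subst y g"
  unfolding cpoly_subst_def
  by (rule setsum_keys_plus_distrib[where f = "\<lambda>m c. cpoly_const c *
        (\<Prod>j \<in> Poly_Mapping.keys m. y j ^ Poly_Mapping.lookup m j)"])
    (simp_all add: cpoly_const_def single_add distrib_right)

lemma cpoly_ring_ring: "ring (cpoly_ring d)"
  using cpoly_ring_cring by (rule cring.axioms)

text \<open>
  Substitution is computed with the arithmetic of the type of polynomials in infinitely many
  variables. Its closure properties on the ring in \<open>d\<close> variables are read off from the record.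
\<close>

lemma cpoly_carrier_closed:
  shows "\<lbrakk>f \<in> carrier (cpoly_ring d); g \<in> carrier (cpoly_ring d)\<rbrakk> \<Longrightarrow> f + g \<in> carrier (cpoly_ring d)"
    and "\<lbrakk>f \<in> carrier (cpoly_ring d); g \<in> carrier (cpoly_ring d)\<rbrakk> \<Longrightarrow> f * g \<in> carrier (cpoly_ring d)"
    and "0 \<in> carrier (cpoly_ring d)"
    and "1 \<in> carrier (cpoly_ring d)"
  using ring.ring_simprules(1,5)[OF cpoly_ring_ring, of f d g]
    ring.ring_simprules(2,6)[OF cpoly_ring_ring, of d]
  unfolding cpoly_ring_def ring_record_simps partial_object.simps monoid.simps
  by blast+

lemma cpoly_const_closed: "cpoly_const c \<in> carrier (cpoly_ring d)"
  by (simp add: cpoly_const_def cpoly_ring_def)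

lemma cpoly_var_closed: "j \<in> {1..d} \<Longrightarrow> cpoly_var j \<in> carrier (cpoly_ring d)"
  by (simp add: cpoly_var_def cpoly_ring_def)

lemma cpoly_power_closed:
  "f \<in> carrier (cpoly_ring d) \<Longrightarrow> f ^ n \<in> carrier (cpoly_ring d)"
  by (induction n) (simp_all add: cpoly_carrier_closed)

lemma cpoly_prod_closed:
  assumes "\<And>i. i \<in> A \<Longrightarrow> f i \<in> carrier (cpoly_ring d)"
  shows "prod f A \<in> carrier (cpoly_ring d)"
  using assms
  by (induction A rule: infinite_finite_induct) (simp_all add: cpoly_carrier_closed)

lemma cpoly_sum_closed:
  assumes "\<And>i. i \<in> A \<Longrightarrow> f i \<in> carrier (cpoly_ring d)"
  shows "sum f A \<in> carrier (cpoly_ring d)"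
  using assms
  by (induction A rule: infinite_finite_induct) (simp_all add: cpoly_carrier_closed)

lemma cpoly_subst_closed:
  assumes "f \<in> carrier (cpoly_ring d)"
    and y: "\<And>j. j \<in> {1..d} \<Longrightarrow> y j \<in> carrier (cpoly_ring d)"
  shows "cpoly_subst y f \<in> carrier (cpoly_ring d)"
proof -
  have "y j \<in> carrier (cpoly_ring d)"
    if "m \<in> Poly_Mapping.keys f" "j \<in> Poly_Mapping.keys m" for m j
  proof (rule y)
    show "j \<in> {1..d}"
      using assms(1) that unfolding cpoly_ring_def partial_object.simps by blast
  qed
  then show ?thesis
    unfolding cpoly_subst_def
    by (intro cpoly_sum_closed cpoly_carrier_closed(2) cpoly_const_closed cpoly_prod_closed
        cpoly_power_closed)
qed

lemma power_subst_closed: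
  "f \<in> carrier (cpoly_ring d) \<Longrightarrow> power_subst i f \<in> carrier (cpoly_ring d)"
  unfolding power_subst_def by (intro cpoly_subst_closed cpoly_power_closed cpoly_var_closed)

lemma power_subst_additive:
  "power_subst i \<in> hom (add_monoid (cpoly_ring d)) (add_monoid (cpoly_ring d))"
proof (rule homI)
  fix f g
  show "power_subst i (f \<otimes>\<^bsub>add_monoid (cpoly_ring d)\<^esub> g) =
      power_subst i f \<otimes>\<^bsub>add_monoid (cpoly_ring d)\<^esub> power_subst i g"
    by (simp add: power_subst_def cpoly_subst_add cpoly_ring_def)
qed (simp add: power_subst_closed)


section \<open>Power-closed ideals\<close>

lemma power_closed_ideal_is_ideal: "power_closed_ideal d I \<Longrightarrow> ideal I (cpoly_ring d)"
  by (simp add: power_closed_ideal_def)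

lemma power_closed_ideals_Inter:
  assumes "\<And>I. I \<in> \<S> \<Longrightarrow> power_closed_ideal d I"
  shows "power_closed_ideal d (ideals_Inter (cpoly_ring d) \<S>)"
proof -
  have "ideal (ideals_Inter (cpoly_ring d) \<S>) (cpoly_ring d)"
    using assms by (intro ring.ideals_Inter_ideal[OF cpoly_ring_ring] power_closed_ideal_is_ideal)
  then show ?thesis
    using assms by (auto simp: power_closed_ideal_def ideals_Inter_def power_subst_closed)
qed

lemma power_closed_ideals_sum:
  assumes pc: "\<And>I. I \<in> \<S> \<Longrightarrow> power_closed_ideal d I"
  shows "power_closed_ideal d (ideals_sum (cpoly_ring d) \<S>)"
proof -
  have "ideal (ideals_sum (cpoly_ring d) \<S>) (cpoly_ring d)"
    using assms by (intro ring.ideals_sum_ideal[OF cpoly_ring_ring] power_closed_ideal_is_ideal)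
  moreover have "power_subst i f \<in> ideals_sum (cpoly_ring d) \<S>"
    if "f \<in> ideals_sum (cpoly_ring d) \<S>" "i \<ge> 1" for f i
  proof (rule ring.ideals_sum_additive_invariant[OF cpoly_ring_ring _ power_subst_additive _ that(1)])
    show "I \<subseteq> carrier (cpoly_ring d)" if "I \<in> \<S>" for I
      using ideal.Icarr[OF power_closed_ideal_is_ideal[OF pc[OF that]]] by blast
    show "power_subst i a \<in> I" if "I \<in> \<S>" "a \<in> I" for I a
      using pc[OF that(1)] that(2) \<open>i \<ge> 1\<close> by (simp add: power_closed_ideal_def)
  qed
  ultimately show ?thesis
    by (simp add: power_closed_ideal_def)
qed

text \<open>
  The family of power-closed ideals above \<open>S\<close> contains the whole ring, so its bare intersection
  already lies in the carrier and agrees with the meet of ideals.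
\<close>

lemma power_closure_eq_ideals_Inter:
  assumes "S \<subseteq> carrier (cpoly_ring d)"
  shows "power_closure d S =
    ideals_Inter (cpoly_ring d) {I. power_closed_ideal d I \<and> S \<subseteq> I}"
proof -
  have "power_closed_ideal d (carrier (cpoly_ring d))"
    by (simp add: power_closed_ideal_def ring.oneideal[OF cpoly_ring_ring] power_subst_closed)
  then show ?thesis
    using assms by (auto simp: power_closure_def ideals_Inter_def)
qed

lemma power_closure_power_closed:
  assumes "S \<subseteq> carrier (cpoly_ring d)"
  shows "power_closed_ideal d (power_closure d S)"
  unfolding power_closure_eq_ideals_Inter[OF assms] by (intro power_closed_ideals_Inter) simp

lemma power_closure_extensive: "S \<subseteq> power_closure d S"
  by (auto simp: power_closure_def)

lemma power_closure_mono: "S \<subseteq> T \<Longrightarrow> power_closure d S \<subseteq> power_closure d T"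
  by (auto simp: power_closure_def)

lemma power_closure_least: "\<lbrakk>power_closed_ideal d I; S \<subseteq> I\<rbrakk> \<Longrightarrow> power_closure d S \<subseteq> I"
  by (auto simp: power_closure_def)

lemma power_closure_idem:
  assumes "S \<subseteq> carrier (cpoly_ring d)"
  shows "power_closure d (power_closure d S) = power_closure d S"
  by (intro equalityI power_closure_extensive power_closure_least
      power_closure_power_closed[OF assms] subset_refl)

lemma power_closed_complete_sublattice:
  "complete_sublattice {I. power_closed_ideal d I} (ideal_lattice (cpoly_ring d))"
  unfolding complete_sublattice_def
proof (intro conjI allI impI)
  show "{I. power_closed_ideal d I} \<subseteq> carrier (ideal_lattice (cpoly_ring d))"
    by (auto simp: ideal_lattice_def power_closed_ideal_is_ideal)
next
  fix \<S> assume "\<S> \<subseteq> {I. power_closed_ideal d I}"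
  then have pc: "power_closed_ideal d I" if "I \<in> \<S>" for I
    using that by blast
  note id = power_closed_ideal_is_ideal[OF pc]
  show "\<Sqinter>\<^bsub>ideal_lattice (cpoly_ring d)\<^esub>\<S> \<in> {I. power_closed_ideal d I}"
    using power_closed_ideals_Inter[OF pc]
    by (simp add: ring.ideal_lattice_sup_inf(2)[OF cpoly_ring_ring id])
  show "\<Squnion>\<^bsub>ideal_lattice (cpoly_ring d)\<^esub>\<S> \<in> {I. power_closed_ideal d I}"
    using power_closed_ideals_sum[OF pc]
    by (simp add: ring.ideal_lattice_sup_inf(1)[OF cpoly_ring_ring id])
qed (rule ring.ideal_lattice_complete[OF cpoly_ring_ring])

theorem proposition2p3:
  fixes d :: nat
  defines "R \<equiv> cpoly_ring d"
  shows "(\<forall>S \<subseteq> carrier R. power_closed_ideal d (power_closure d S))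
    \<and> (\<forall>S \<subseteq> carrier R. S \<subseteq> power_closure d S)
    \<and> (\<forall>S T. S \<subseteq> T \<and> T \<subseteq> carrier R \<longrightarrow> power_closure d S \<subseteq> power_closure d T)
    \<and> (\<forall>S \<subseteq> carrier R. power_closure d (power_closure d S) = power_closure d S)
    \<and> complete_lattice (ideal_lattice R)
    \<and> (\<forall>\<S>. (\<forall>I \<in> \<S>. ideal I R) \<longrightarrow>
          \<Sqinter>\<^bsub>ideal_lattice R\<^esub>\<S> = ideals_Inter R \<S> \<and> \<Squnion>\<^bsub>ideal_lattice R\<^esub>\<S> = ideals_sum R \<S>)
    \<and> complete_sublattice {I. power_closed_ideal d I} (ideal_lattice R)
    \<and> (\<forall>\<S>. (\<forall>I \<in> \<S>. power_closed_ideal d I) \<longrightarrow>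
          power_closed_ideal d (ideals_Inter R \<S>) \<and> power_closed_ideal d (ideals_sum R \<S>))"
  unfolding R_def
  by (intro conjI allI impI)
    (simp_all add: power_closure_power_closed power_closure_extensive power_closure_mono
      power_closure_idem ring.ideal_lattice_complete[OF cpoly_ring_ring]
      ring.ideal_lattice_sup_inf[OF cpoly_ring_ring]
      power_closed_complete_sublattice power_closed_ideals_Inter power_closed_ideals_sum)

end
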